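(* Let $N,d\ge1$ be integers, $\eta>0$, $\lambda\ge0$, and let $L^1:\mathbb{R}^{1\times d}\to\mathbb{R}_{\ge0}$ be the (differentiable) training loss of the linear model with a single output ($k=1$). Then the end-to-end update rule on $W_e\in\mathbb{R}^{1\times d}$, $$W_e^{(t+1)}=(1-\eta\lambda N)W_e^{(t)}-\eta\sum_{j=1}^N\big[W_e^{(t)}(W_e^{(t)})^\top\big]^{\frac{j-1}{N}}\cdot\frac{dL^1}{dW}(W_e^{(t)})\cdot\big[(W_e^{(t)})^\top W_e^{(t)}\big]^{\frac{N-j}{N}},$$ can be written as $$W_e^{(t+1)}=(1-\eta\lambda N)\cdot W_e^{(t)}-\eta\,\|W_e^{(t)}\|_2^{2-\frac2N}\cdot\Big(\frac{dL^1}{dW}(W_e^{(t)})+(N-1)\cdot Pr_{W_e^{(t)}}\Big\{\frac{dL^1}{dW}(W_e^{(t)})\Big\}\Big),$$ where $\|\cdot\|_2^{2-\frac2N}$ is the Euclidean norm raised to the power $2-\frac2N$, and for $W\in\mathbb{R}^{1\times d}$, $Pr_W:\mathbb{R}^{1\times d}\to\mathbb{R}^{1\times d}$ is the projection onto the direction of $W$: $$Pr_W\{V\}:=\begin{cases}\dfrac{W}{\|W\|_2}V^\top\cdot\dfrac{W}{\|W\|_2}, & W\ne0,\\[2mm] 0, & W=0.\end{cases}$$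
   Context: Training loss: given training data $(\mathbf{x}^{(i)},y^{(i)})\in\mathbb{R}^d\times\mathbb{R}$, $i=1,\dots,m$, and a point-wise loss $l:\mathbb{R}\times\mathbb{R}\to\mathbb{R}_{\ge0}$ (such that the gradient exists), $L^1(W):=\frac1m\sum_{i=1}^m l(W\mathbf{x}^{(i)},y^{(i)})$ for $W\in\mathbb{R}^{1\times d}$. $\frac{dL^1}{dW}(W)\in\mathbb{R}^{1\times d}$ is the row vector of partial derivatives. Fractional powers: for a real symmetric positive semidefinite matrix $A=Q\,\mathrm{diag}(a_1,\dots,a_n)Q^\top$ ($Q$ orthogonal, $a_i\ge0$) and $s\ge0$, $[A]^s:=Q\,\mathrm{diag}(a_1^s,\dots,a_n^s)Q^\top$, with $[A]^0$ the identity matrix; correspondingly $0^0=1$ for scalars (relevant for $N=1$). *)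

theory Defs
  imports "HOL-Analysis.Analysis"
begin

text \<open>Row vectors in $\mathbb{R}^{1\times d}$ have type \<open>real ^ 'd ^ 1\<close>; the library norm
  on this type is the square root of the sum of the squares of all entries, that is, the Euclidean
  norm. Data points \<open>x i\<close>, \<open>y i\<close> are indexed by \<open>1, \<dots>, m\<close>.\<close>

definition training_loss ::
    "nat \<Rightarrow> (nat \<Rightarrow> real ^ 'd) \<Rightarrow> (nat \<Rightarrow> real) \<Rightarrow> (real \<Rightarrow> real \<Rightarrow> real) \<Rightarrow> real ^ 'd ^ 1 \<Rightarrow> real"
  where "training_loss m x y l W = 1 / real m * (\<Sum>i=1..m. l ((W *v x i) $ 1) (y i))"

definition matrix_gradient :: "(real ^ 'd ^ 'k \<Rightarrow> real) \<Rightarrow> real ^ 'd ^ 'k \<Rightarrow> real ^ 'd ^ 'k"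
  where "matrix_gradient f W = (\<chi> i j. deriv (\<lambda>h. f (W + h *\<^sub>R axis i (axis j 1))) 0)"

text \<open>Real powers with the convention $0^0 = 1$; the library has \<open>0 powr 0 = 0\<close>.\<close>

definition rpow :: "real \<Rightarrow> real \<Rightarrow> real"
  where "rpow a s = (if s = 0 then 1 else a powr s)"

definition diag_matrix :: "real ^ 'n \<Rightarrow> real ^ 'n ^ 'n"
  where "diag_matrix a = (\<chi> i j. if i = j then a $ i else 0)"

text \<open>Fractional power of a symmetric positive semidefinite matrix. Such a matrix has an orthogonal
  diagonalization with nonnegative entries, and the result does not depend on which one is chosen
  (\<open>matrix_rpow_unique\<close>).\<close>

definition matrix_rpow :: "real ^ 'n ^ 'n \<Rightarrow> real \<Rightarrow> real ^ 'n ^ 'n"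
  where "matrix_rpow A s = (THE B. \<exists>Q a. orthogonal_matrix Q \<and> (\<forall>i. 0 \<le> a $ i) \<and>
           A = Q ** diag_matrix a ** transpose Q \<and>
           B = Q ** diag_matrix (\<chi> i. rpow (a $ i) s) ** transpose Q)"

definition Pr :: "real ^ 'd ^ 1 \<Rightarrow> real ^ 'd ^ 1 \<Rightarrow> real ^ 'd ^ 1"
  where "Pr W V = (if W = 0 then 0
           else ((1 / norm W) *\<^sub>R W) ** transpose V ** ((1 / norm W) *\<^sub>R W))"

lemma diag_matrix_mult_left: "(diag_matrix a ** R) $ i $ j = a $ i * R $ i $ j"
  by (simp add: diag_matrix_def matrix_matrix_mult_def if_distrib[of "\<lambda>x. x * _"] cong: if_cong)

lemma diag_matrix_mult_right: "(R ** diag_matrix a) $ i $ j = R $ i $ j * a $ j"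
  by (simp add: diag_matrix_def matrix_matrix_mult_def if_distrib[of "\<lambda>x. _ * x"] cong: if_cong)

lemma matrix_rpow_unique:
  fixes Q P :: "real ^ 'n ^ 'n"
  assumes Q: "orthogonal_matrix Q" and P: "orthogonal_matrix P"
    and eq: "Q ** diag_matrix a ** transpose Q = P ** diag_matrix b ** transpose P"
  shows "Q ** diag_matrix (\<chi> i. rpow (a $ i) s) ** transpose Q
       = P ** diag_matrix (\<chi> i. rpow (b $ i) s) ** transpose P"
proof -
  have QQ: "transpose Q ** Q = mat 1" "Q ** transpose Q = mat 1"
    and PP: "transpose P ** P = mat 1" "P ** transpose P = mat 1"
    using Q P by (auto simp: orthogonal_matrix_def)
  define R where "R = transpose P ** Q"
  have "R ** diag_matrix a = transpose P ** (Q ** diag_matrix a ** transpose Q) ** Q"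
    by (metis R_def QQ(1) matrix_mul_assoc matrix_mul_rid)
  also have "\<dots> = diag_matrix b ** R"
    unfolding eq by (metis R_def PP(1) matrix_mul_assoc matrix_mul_lid)
  finally have *: "R $ i $ j * a $ j = b $ i * R $ i $ j" for i j
    by (metis diag_matrix_mult_left diag_matrix_mult_right)
  have "R ** diag_matrix (\<chi> i. rpow (a $ i) s) = diag_matrix (\<chi> i. rpow (b $ i) s) ** R"
    unfolding vec_eq_iff diag_matrix_mult_left diag_matrix_mult_right
    using * by (metis mult.commute mult_cancel_left vec_lambda_beta)
  then have "P ** (R ** diag_matrix (\<chi> i. rpow (a $ i) s)) ** transpose Q
           = P ** (diag_matrix (\<chi> i. rpow (b $ i) s) ** R) ** transpose Q"
    by simp
  moreover have "P ** (R ** D) ** transpose Q = Q ** D ** transpose Q" for D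
    by (metis R_def PP(2) matrix_mul_assoc matrix_mul_lid)
  moreover have "P ** (D ** R) ** transpose Q = P ** D ** transpose P" for D
    by (metis R_def QQ(2) matrix_mul_assoc matrix_mul_rid)
  ultimately show ?thesis
    by simp
qed

lemma matrix_rpow_eqI:
  fixes Q :: "real ^ 'n ^ 'n"
  assumes "orthogonal_matrix Q" "\<And>i. 0 \<le> a $ i"
  shows "matrix_rpow (Q ** diag_matrix a ** transpose Q) s
       = Q ** diag_matrix (\<chi> i. rpow (a $ i) s) ** transpose Q"
  unfolding matrix_rpow_def
proof (rule the_equality)
  fix B
  assume "\<exists>Q' a'. orthogonal_matrix Q' \<and> (\<forall>i. 0 \<le> a' $ i) \<and>
      Q ** diag_matrix a ** transpose Q = Q' ** diag_matrix a' ** transpose Q' \<and>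
      B = Q' ** diag_matrix (\<chi> i. rpow (a' $ i) s) ** transpose Q'"
  then show "B = Q ** diag_matrix (\<chi> i. rpow (a $ i) s) ** transpose Q"
    using matrix_rpow_unique[OF assms(1)] by metis
qed (use assms in blast)

end

theory Submission
  imports Defs
begin

text \<open>
  Write \<open>W = n U\<close> with \<open>n = norm W\<close> and a unit row vector \<open>U\<close> (arbitrary if \<open>W = 0\<close>), and let
  \<open>P = transpose U ** U\<close>. Then \<open>W ** transpose W\<close> is the scalar \<open>n^2\<close> and
  \<open>transpose W ** W = n^2 P\<close>, whose power \<open>s\<close> is \<open>n^(2 s) P + 0^s (I - P)\<close>. In the sum, each of the
  \<open>N\<close> summands has the factor \<open>n^(2 (N - 1) / N)\<close>, since the two exponents always add up to
  \<open>(N - 1) / N\<close>. The complement \<open>I - P\<close> survives only for \<open>j = N\<close>, where the right exponent is \<open>0\<close>.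
\<close>

lemma rpow_0_right [simp]: "rpow a 0 = 1"
  by (simp add: rpow_def)

lemma rpow_0_left: "rpow 0 s = (if s = 0 then 1 else 0)"
  by (simp add: rpow_def)

text \<open>At \<open>a = 0\<close> this survives the convention \<open>rpow 0 0 = 1\<close>:
  nonnegative exponents have sum 0 only if both are 0.\<close>

lemma rpow_add:
  assumes "0 \<le> a" "0 \<le> s" "0 \<le> r"
  shows "rpow a (s + r) = rpow a s * rpow a r"
  using assms by (auto simp: rpow_def powr_add add_nonneg_eq_0_iff)

lemma rpow_power2:
  assumes "0 \<le> a"
  shows "rpow (a\<^sup>2) s = rpow a (2 * s)"
proof (cases "a = 0")
  case False
  with assms have "a\<^sup>2 = a powr 2" by simp
  then show ?thesis by (simp add: rpow_def powr_powr)
qed (simp add: rpow_def)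

lemma matrix_diff_ldistrib:
  fixes A :: "'a::ring_1 ^ 'n ^ 'm" and B C :: "'a ^ 'p ^ 'n"
  shows "A ** (B - C) = A ** B - A ** C"
  by (simp add: vec_eq_iff matrix_matrix_mult_def sum_subtractf right_diff_distrib)

lemma matrix_mult_scaleR_right:
  fixes A :: "'a::real_algebra_1 ^ 'n ^ 'm" and B :: "'a ^ 'p ^ 'n"
  shows "A ** (c *\<^sub>R B) = c *\<^sub>R (A ** B)"
  by (simp add: matrix_scalar_ac scalar_matrix_assoc)

lemma norm_row_vector: "norm (U :: real ^ 'd ^ 1) = norm (U $ 1)"
  unfolding norm_vec_def[of U] by simp

lemma row_mult_transpose: "U ** transpose U = (norm (U :: real ^ 'd ^ 1))\<^sup>2 *\<^sub>R mat 1"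
  by (simp add: vec_eq_iff matrix_matrix_mult_def transpose_def mat_def norm_row_vector
      power2_norm_eq_inner inner_vec_def)

lemma transpose_mult_row: "(transpose U ** (U :: real ^ 'd ^ 1)) $ i $ j = U $ 1 $ i * U $ 1 $ j"
  by (simp add: matrix_matrix_mult_def transpose_def)

text \<open>The product \<open>U ** transpose V\<close> is 1 by 1, hence equal to its transpose
  \<open>V ** transpose U\<close>; the rest is associativity.\<close>

lemma row_mult_transpose_assoc:
  fixes U V :: "real ^ 'd ^ 1"
  shows "U ** transpose V ** U = V ** (transpose U ** U)"
  by (simp add: vec_eq_iff matrix_matrix_mult_def transpose_def sum_distrib_left mult_ac)

lemma matrix_rpow_scaleR_mat:
  assumes "0 \<le> c"
  shows "matrix_rpow (c *\<^sub>R mat 1 :: real ^ 'n ^ 'n) s = rpow c s *\<^sub>R mat 1"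
proof -
  have *: "diag_matrix (\<chi> i. b) = b *\<^sub>R (mat 1 :: real ^ 'n ^ 'n)" for b
    by (simp add: vec_eq_iff diag_matrix_def mat_def)
  show ?thesis
    using matrix_rpow_eqI[of "mat 1 :: real ^ 'n ^ 'n" "\<chi> i. c" s] assms
    by (simp add: * orthogonal_matrix_id)
qed

text \<open>An orthonormal basis containing \<open>U\<close> diagonalizes
  \<open>c *\<^sub>R P\<close>, with entry \<open>c\<close> at \<open>U\<close> and 0 at all other
  basis vectors. The zeros turn into \<open>rpow 0 s\<close> on the orthogonal complement.\<close>

lemma matrix_rpow_scaleR_projection:
  fixes U :: "real ^ 'd ^ 1"
  assumes "norm U = 1" "0 \<le> c"
  defines "P \<equiv> transpose U ** U"
  shows "matrix_rpow (c *\<^sub>R P) s = rpow c s *\<^sub>R P + rpow 0 s *\<^sub>R (mat 1 - P)"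
proof -
  \<comment> \<open>An arbitrary index, marking the column of \<open>Q\<close> that is to hold
    \<open>U\<close>.\<close>
  fix k :: 'd
  obtain Q :: "real ^ 'd ^ 'd" where Q: "orthogonal_matrix Q" "Q *v axis k 1 = U $ 1"
    using orthogonal_matrix_exists_basis[of "U $ 1" k] assms(1) by (metis norm_row_vector)
  have Qk: "Q $ i $ k = U $ 1 $ i" for i
    using Q(2) by (metis matrix_vector_mul_component inner_axis inner_real_def mult.right_neutral
        inner_commute)
  have conj: "Q ** diag_matrix (\<chi> i. if i = k then b else e) ** transpose Q
      = b *\<^sub>R P + e *\<^sub>R (mat 1 - P)" for b e
  proof -
    \<comment> \<open>The diagonal is split into the constant \<open>e\<close>, which yields
      \<open>e\<close> times \<open>Q ** transpose Q\<close>, and the excess \<open>b - e\<close> at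
      \<open>k\<close>.\<close>
    have "(\<Sum>r\<in>UNIV. Q $ i $ r * (if r = k then b else e) * Q $ j $ r)
        = (b - e) * (Q $ i $ k * Q $ j $ k) + e * (Q ** transpose Q) $ i $ j" for i j
    proof -
      have "(\<Sum>r\<in>UNIV. Q $ i $ r * (if r = k then b else e) * Q $ j $ r)
         = (\<Sum>r\<in>UNIV. (if r = k then (b - e) * (Q $ i $ r * Q $ j $ r) else 0)
             + e * (Q $ i $ r * Q $ j $ r))"
        by (rule sum.cong) (auto simp: algebra_simps)
      then show ?thesis
        by (simp add: sum.distrib sum_distrib_left matrix_matrix_mult_def transpose_def)
    qed
    moreover have "Q ** transpose Q = mat 1"
      using Q(1) by (simp add: orthogonal_matrix_def)
    ultimately have "(Q ** diag_matrix (\<chi> i. if i = k then b else e) ** transpose Q) $ i $ j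
        = (b - e) * P $ i $ j + e * mat 1 $ i $ j" for i j
      by (subst matrix_matrix_mult_def)
        (simp add: diag_matrix_mult_right Qk P_def transpose_mult_row transpose_def[of Q])
    then show ?thesis
      by (simp add: vec_eq_iff algebra_simps)
  qed
  have "(\<chi> i. rpow ((\<chi> i. if i = k then c else 0) $ i) s)
      = (\<chi> i. if i = k then rpow c s else rpow 0 s)"
    by (simp add: vec_eq_iff)
  then show ?thesis
    using matrix_rpow_eqI[OF Q(1), of "\<chi> i. if i = k then c else 0" s] conj[of c 0]
      conj[of "rpow c s" "rpow 0 s"] assms(2) by simp
qed

lemma Pr_scaleR_unit:
  assumes "norm U = 1" "0 < n"
  shows "Pr (n *\<^sub>R U) V = V ** (transpose U ** U)"
proof -
  from assms have "U \<noteq> 0" by auto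
  with assms show ?thesis
    by (simp add: Pr_def row_mult_transpose_assoc)
qed

text \<open>The loss enters the update only through its gradient at \<open>W\<close>, so an
  arbitrary row vector \<open>V\<close> can take the gradient's place.\<close>

lemma end_to_end_sum_eq:
  fixes W V :: "real ^ 'd ^ 1"
  assumes N: "1 \<le> N"
  shows "(\<Sum>j=1..N. matrix_rpow (W ** transpose W) ((real j - 1) / real N) ** V
            ** matrix_rpow (transpose W ** W) ((real N - real j) / real N))
       = rpow (norm W) (2 - 2 / real N) *\<^sub>R (V + (real N - 1) *\<^sub>R Pr W V)"
proof -
  define n where "n = norm W"
  have n: "0 \<le> n" by (simp add: n_def)
  obtain U :: "real ^ 'd ^ 1" where U: "norm U = 1" "W = n *\<^sub>R U"
  proof (cases "W = 0")
    case True
    then show ?thesis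
      using that vector_choose_size[of 1] by (metis n_def norm_zero scaleR_zero_left zero_le_one)
  next
    case False
    then show ?thesis
      using that[of "(1 / n) *\<^sub>R W"] by (simp add: n_def)
  qed
  define P where "P = transpose U ** U"
  define e where "e = rpow n (2 - 2 / real N)"
  have WW: "W ** transpose W = n\<^sup>2 *\<^sub>R mat 1"
    by (simp add: row_mult_transpose n_def)
  have WtW: "transpose W ** W = n\<^sup>2 *\<^sub>R P"
    by (simp add: P_def vec_eq_iff transpose_mult_row U(2) power2_eq_square)
  have summand: "matrix_rpow (W ** transpose W) ((real j - 1) / real N) ** V
        ** matrix_rpow (transpose W ** W) ((real N - real j) / real N)
      = e *\<^sub>R (V ** P) + (if j = N then e *\<^sub>R (V - V ** P) else 0)" (is "?lhs = _")
    if j: "j \<in> {1..N}" for j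
  proof -
    define s r where "s = (real j - 1) / real N" and "r = (real N - real j) / real N"
    have sr: "0 \<le> s" "0 \<le> r" "2 * (s + r) = 2 - 2 / real N" "r = 0 \<longleftrightarrow> j = N"
      using j N by (auto simp: s_def r_def field_simps)
    have e: "rpow (n\<^sup>2) s * rpow (n\<^sup>2) r = e"
      using sr n by (simp add: rpow_power2 e_def flip: rpow_add)
    have "?lhs = (rpow (n\<^sup>2) s *\<^sub>R mat 1) ** V ** (rpow (n\<^sup>2) r *\<^sub>R P + rpow 0 r *\<^sub>R (mat 1 - P))"
      unfolding WW WtW s_def[symmetric] r_def[symmetric]
      by (simp add: matrix_rpow_scaleR_mat matrix_rpow_scaleR_projection[OF U(1)] P_def)
    also have "\<dots> = (rpow (n\<^sup>2) s * rpow (n\<^sup>2) r) *\<^sub>R (V ** P)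
        + (rpow (n\<^sup>2) s * rpow 0 r) *\<^sub>R (V - V ** P)"
      by (simp add: matrix_add_ldistrib matrix_diff_ldistrib matrix_mult_scaleR_right algebra_simps
          flip: scalar_matrix_assoc)
    \<comment> \<open>For \<open>j = N\<close> the exponent \<open>r\<close> is 0, so
      \<open>rpow (n\<^sup>2) s\<close> alone is already \<open>e\<close>.\<close>
    also have "\<dots> = e *\<^sub>R (V ** P) + (if j = N then e *\<^sub>R (V - V ** P) else 0)"
      using e sr by (auto simp: rpow_0_left)
    finally show ?thesis .
  qed
  \<comment> \<open>For \<open>W = 0\<close> the vectors \<open>Pr W V\<close> and
    \<open>V ** P\<close> may differ, since \<open>U\<close> is then arbitrary. The coefficient
    vanishes in that case: \<open>e = 0\<close> if \<open>N > 1\<close>, and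
    \<open>real N - 1 = 0\<close> if \<open>N = 1\<close>.\<close>
  have Pr: "(e * (real N - 1)) *\<^sub>R Pr W V = (e * (real N - 1)) *\<^sub>R (V ** P)"
  proof (cases "n = 0")
    case True
    then have "e * (real N - 1) = 0"
      using N by (auto simp: e_def rpow_0_left field_simps)
    then show ?thesis by simp
  next
    case False
    then show ?thesis
      using U n by (simp add: Pr_scaleR_unit P_def)
  qed
  have "(\<Sum>j=1..N. matrix_rpow (W ** transpose W) ((real j - 1) / real N) ** V
          ** matrix_rpow (transpose W ** W) ((real N - real j) / real N))
      = (\<Sum>j=1..N. e *\<^sub>R (V ** P) + (if j = N then e *\<^sub>R (V - V ** P) else 0))"
    by (rule sum.cong) (simp_all only: summand)
  also have "\<dots> = real N *\<^sub>R e *\<^sub>R (V ** P) + e *\<^sub>R (V - V ** P)"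
    using N by (simp add: sum.distrib sum_constant_scaleR del: sum_constant)
  also have "\<dots> = e *\<^sub>R V + (e * (real N - 1)) *\<^sub>R (V ** P)"
    by (simp add: algebra_simps)
  finally show ?thesis
    unfolding Pr[symmetric] by (simp only: e_def n_def scaleR_add_right scaleR_scaleR)
qed

theorem claim2:
  fixes N m t :: nat and \<eta> lam :: real
    and x :: "nat \<Rightarrow> real ^ 'd" and y :: "nat \<Rightarrow> real" and l :: "real \<Rightarrow> real \<Rightarrow> real"
    and L1 :: "real ^ 'd ^ 1 \<Rightarrow> real" and W\<^sub>e :: "nat \<Rightarrow> real ^ 'd ^ 1"
  assumes "1 \<le> N" and "1 \<le> m" and "0 < \<eta>" and "0 \<le> lam"
    and "\<And>p q. 0 \<le> l p q"
    and "L1 = training_loss m x y l"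
    and "\<And>W. L1 differentiable (at W)"
  shows
    "W\<^sub>e (Suc t) = (1 - \<eta> * lam * real N) *\<^sub>R W\<^sub>e t
        - \<eta> *\<^sub>R (\<Sum>j=1..N. matrix_rpow (W\<^sub>e t ** transpose (W\<^sub>e t)) ((real j - 1) / real N)
                        ** matrix_gradient L1 (W\<^sub>e t)
                        ** matrix_rpow (transpose (W\<^sub>e t) ** W\<^sub>e t) ((real N - real j) / real N))
     \<longleftrightarrow>
     W\<^sub>e (Suc t) = (1 - \<eta> * lam * real N) *\<^sub>R W\<^sub>e t
        - (\<eta> * rpow (norm (W\<^sub>e t)) (2 - 2 / real N)) *\<^sub>R
            (matrix_gradient L1 (W\<^sub>e t)
              + (real N - 1) *\<^sub>R Pr (W\<^sub>e t) (matrix_gradient L1 (W\<^sub>e t)))"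
  unfolding end_to_end_sum_eq[OF \<open>1 \<le> N\<close>] by simp

end
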